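(* (1) For any $a, b \in \mathbf{H}_0^{*}$ such that $N(a) = N(b)$, there exists $p \in \mathbf{H}_0^{*}$ such that $pap^{-1} = b$. (2) Let $K = \mathbf{H}'$ or $K = \mathbf{H}^C$. For any $a, b \in K_0^{*}$ such that $N(a) = N(b)$, there exists $p \in K^{\times}$ such that $pap^{-1} = b$.
   Context: Let $\mathbf{H}$ be the real quaternion algebra with $\mathbb{R}$-basis $1, e_1, e_2, e_3$ and $e_1^2=e_2^2=e_3^2=-1$, $e_1e_2=e_3=-e_2e_1$, $e_2e_3=e_1=-e_3e_2$, $e_3e_1=e_2=-e_1e_3$. Let $\mathbf{H}^C=\mathbf{H}\oplus i\mathbf{H}$ be its complexification (complex quaternion algebra). Let $\mathbf{H}'$ be the split quaternion algebra: the real associative algebra with $\mathbb{R}$-basis $1, e_1', e_2, e_3'$ and $e_1'^2=e_3'^2=1$, $e_2^2=-1$, $e_1'e_2=e_3'=-e_2e_1'$, $e_2e_3'=e_1'=-e_3'e_2$, $e_3'e_1'=-e_2=-e_1'e_3'$. In $\mathbf{H}$ and $\mathbf{H}'$, the conjugation $a\mapsto\overline{a}$ is the $\mathbb{R}$-linear map fixing $1$ and negating the other three basis elements; it is extended complex-linearly to $\mathbf{H}^C$. For $K$ any of $\mathbf{H},\mathbf{H}',\mathbf{H}^C$: the inner product is $(a,b)=\frac12(a\overline{b}+b\overline{a})$ and the norm is $N(a)=(a,a)=a\overline{a}$ (real-valued for $\mathbf{H},\mathbf{H}'$, complex-valued for $\mathbf{H}^C$). If $N(a)\neq0$ then $a$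 is invertible with $a^{-1}=\overline{a}/N(a)$. Put $K_0=\{a\in K\mid\overline{a}=-a\}$, $K_0^{*}=\{a\in K_0\mid a\neq0\}$, $K^{\times}=\{a\in K\mid N(a)\neq0\}$. *)

theory Defs
  imports Complex_Main
begin

section \<open>Quaternions over a commutative coefficient ring\<close>

text \<open>
  One type serves for both \<open>H\<close> (\<open>'a = real\<close>) and its complexification
  \<open>H \<oplus> i H\<close> (\<open>'a = complex\<close>).  The lemmas \<open>complexification_*\<close> below justify the latter.
\<close>

datatype 'a quat = Quat (q0: 'a) (q1: 'a) (q2: 'a) (q3: 'a)

type_synonym quaternion = "real quat"
type_synonym complex_quaternion = "complex quat"

lemma quat_eq_iff: "x = y \<longleftrightarrow> q0 x = q0 y \<and> q1 x = q1 y \<and> q2 x = q2 y \<and> q3 x = q3 y"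
  by (auto intro: quat.expand)

instantiation quat :: (comm_ring_1) ring_1
begin

definition "0 = Quat 0 0 0 0"
definition "1 = Quat 1 0 0 0"
definition "x + y = Quat (q0 x + q0 y) (q1 x + q1 y) (q2 x + q2 y) (q3 x + q3 y)"
definition "- x = Quat (- q0 x) (- q1 x) (- q2 x) (- q3 x)"
definition "x - y = Quat (q0 x - q0 y) (q1 x - q1 y) (q2 x - q2 y) (q3 x - q3 y)"
definition "x * y = Quat
  (q0 x * q0 y - q1 x * q1 y - q2 x * q2 y - q3 x * q3 y)
  (q0 x * q1 y + q1 x * q0 y + q2 x * q3 y - q3 x * q2 y)
  (q0 x * q2 y + q2 x * q0 y + q3 x * q1 y - q1 x * q3 y)
  (q0 x * q3 y + q3 x * q0 y + q1 x * q2 y - q2 x * q1 y)"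

instance
  by standard (auto simp: zero_quat_def one_quat_def plus_quat_def uminus_quat_def
      minus_quat_def times_quat_def algebra_simps)

end

lemmas quat_ring_defs = zero_quat_def one_quat_def plus_quat_def uminus_quat_def
  minus_quat_def times_quat_def

instantiation quat :: ("{real_algebra_1, comm_ring_1}") real_algebra_1
begin

definition "r *\<^sub>R x = Quat (r *\<^sub>R q0 x) (r *\<^sub>R q1 x) (r *\<^sub>R q2 x) (r *\<^sub>R q3 x)"

instance
  by standard (auto simp: scaleR_quat_def quat_ring_defs algebra_simps)

end

definition qscale :: "'a::comm_ring_1 \<Rightarrow> 'a quat \<Rightarrow> 'a quat" where
  "qscale c x = Quat (c * q0 x) (c * q1 x) (c * q2 x) (c * q3 x)"

definition e1 :: "'a::comm_ring_1 quat" where "e1 = Quat 0 1 0 0"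
definition e2 :: "'a::comm_ring_1 quat" where "e2 = Quat 0 0 1 0"
definition e3 :: "'a::comm_ring_1 quat" where "e3 = Quat 0 0 0 1"

lemma quat_basis:
  "x = qscale (q0 x) 1 + qscale (q1 x) e1 + qscale (q2 x) e2 + qscale (q3 x) e3"
  by (simp add: quat_eq_iff qscale_def quat_ring_defs e1_def e2_def e3_def)

lemma quat_mult_table:
  "e1 * e1 = - 1" "e2 * e2 = - 1" "e3 * e3 = - 1"
  "e1 * e2 = e3" "e2 * e1 = - e3"
  "e2 * e3 = e1" "e3 * e2 = - e1"
  "e3 * e1 = e2" "e1 * e3 = - e2"
  by (simp_all add: quat_ring_defs e1_def e2_def e3_def)

definition qconj :: "'a::comm_ring_1 quat \<Rightarrow> 'a quat" where
  "qconj x = Quat (q0 x) (- q1 x) (- q2 x) (- q3 x)"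

text \<open>
  The element \<open>(x \<cdot> conj y + y \<cdot> conj x) / 2\<close> is a scalar multiple of \<open>1\<close>
  (\<open>qinner_scalar\<close>), so its value in the coefficient field is its \<open>1\<close>-coordinate.
\<close>

definition qinner :: "'a::field_char_0 quat \<Rightarrow> 'a quat \<Rightarrow> 'a" where
  "qinner x y = q0 (qscale (1/2) (x * qconj y + y * qconj x))"

definition qnorm :: "'a::field_char_0 quat \<Rightarrow> 'a" where
  "qnorm x = qinner x x"

lemma qinner_scalar:
  "qscale (qinner x y) 1 = qscale (1/2) (x * qconj y + y * qconj x)"
  by (simp add: quat_eq_iff qinner_def qconj_def qscale_def quat_ring_defs algebra_simps)

lemma qnorm_scalar: "qscale (qnorm x) 1 = x * qconj x"
  by (simp add: quat_eq_iff qnorm_def qinner_def qconj_def qscale_def quat_ring_defs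
      algebra_simps)

text \<open>As for division in HOL, \<open>inverse x\<close> is \<open>0\<close> when \<open>qnorm x = 0\<close>.\<close>

instantiation quat :: (field_char_0) inverse
begin

definition "inverse x = qscale (1 / qnorm x) (qconj x)"
definition "x div y = x * inverse y" for x y :: "'a quat"

instance ..

end

lemma quat_inverse:
  fixes x :: "'a::field_char_0 quat"
  assumes "qnorm x \<noteq> 0"
  shows "x * inverse x = 1" "inverse x * x = 1"
proof -
  have n: "qnorm x = q0 x * q0 x + q1 x * q1 x + q2 x * q2 x + q3 x * q3 x"
    by (simp add: qnorm_def qinner_def qconj_def qscale_def quat_ring_defs)
  have c: "x * qscale c y = qscale c (x * y)" "qscale c y * x = qscale c (y * x)"
    for c and y :: "'a quat"
    by (simp_all add: qscale_def quat_ring_defs algebra_simps)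
  have "x * qconj x = qscale (qnorm x) 1" "qconj x * x = qscale (qnorm x) 1"
    by (simp_all add: n quat_eq_iff qconj_def qscale_def quat_ring_defs)
  with assms show "x * inverse x = 1" "inverse x * x = 1"
    by (simp_all add: inverse_quat_def c) (simp_all add: qscale_def one_quat_def)
qed

definition qpure :: "'a::comm_ring_1 quat set" where
  "qpure = {x. qconj x = - x}"

definition qpure_nonzero :: "'a::comm_ring_1 quat set" where
  "qpure_nonzero = {x \<in> qpure. x \<noteq> 0}"

definition qunits :: "'a::field_char_0 quat set" where
  "qunits = {x. qnorm x \<noteq> 0}"

subsection \<open>The complexification\<close>

definition cquat_of :: "quaternion \<Rightarrow> complex_quaternion" where
  "cquat_of = map_quat complex_of_real"

lemma cquat_of_sel [simp]:
  "q0 (cquat_of x) = of_real (q0 x)" "q1 (cquat_of x) = of_real (q1 x)"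
  "q2 (cquat_of x) = of_real (q2 x)" "q3 (cquat_of x) = of_real (q3 x)"
  by (cases x; simp add: cquat_of_def)+

lemma complexification_decomp: "\<exists>!(x, y). z = cquat_of x + qscale \<i> (cquat_of y)"
proof (rule ex1I[of _ "(Quat (Re (q0 z)) (Re (q1 z)) (Re (q2 z)) (Re (q3 z)),
                         Quat (Im (q0 z)) (Im (q1 z)) (Im (q2 z)) (Im (q3 z)))"])
qed (auto simp: quat_eq_iff plus_quat_def qscale_def complex_eq_iff)

lemma complexification_mult:
  "(cquat_of x + qscale \<i> (cquat_of y)) * (cquat_of u + qscale \<i> (cquat_of v)) =
   cquat_of (x * u - y * v) + qscale \<i> (cquat_of (x * v + y * u))"
  by (simp add: quat_eq_iff quat_ring_defs qscale_def algebra_simps complex_eq_iff)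

lemma complexification_conj:
  "qconj (cquat_of x + qscale \<i> (cquat_of y)) =
   cquat_of (qconj x) + qscale \<i> (cquat_of (qconj y))"
  by (simp add: quat_eq_iff quat_ring_defs qscale_def qconj_def)

section \<open>Split quaternions\<close>

text \<open>\<open>SQuat a b c d\<close> is \<open>a + b e1' + c e2 + d e3'\<close>.\<close>

datatype split_quat = SQuat (s0: real) (s1: real) (s2: real) (s3: real)

lemma split_quat_eq_iff:
  "x = y \<longleftrightarrow> s0 x = s0 y \<and> s1 x = s1 y \<and> s2 x = s2 y \<and> s3 x = s3 y"
  by (auto intro: split_quat.expand)

instantiation split_quat :: real_algebra_1
begin

definition "0 = SQuat 0 0 0 0"
definition "1 = SQuat 1 0 0 0"
definition "x + y = SQuat (s0 x + s0 y) (s1 x + s1 y) (s2 x + s2 y) (s3 x + s3 y)"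
definition "- x = SQuat (- s0 x) (- s1 x) (- s2 x) (- s3 x)"
definition "x - y = SQuat (s0 x - s0 y) (s1 x - s1 y) (s2 x - s2 y) (s3 x - s3 y)"
definition "x * y = SQuat
  (s0 x * s0 y + s1 x * s1 y - s2 x * s2 y + s3 x * s3 y)
  (s0 x * s1 y + s1 x * s0 y + s2 x * s3 y - s3 x * s2 y)
  (s0 x * s2 y + s2 x * s0 y + s1 x * s3 y - s3 x * s1 y)
  (s0 x * s3 y + s3 x * s0 y + s1 x * s2 y - s2 x * s1 y)"
definition "r *\<^sub>R x = SQuat (r * s0 x) (r * s1 x) (r * s2 x) (r * s3 x)"

instance
  by standard (auto simp: zero_split_quat_def one_split_quat_def plus_split_quat_def
      uminus_split_quat_def minus_split_quat_def times_split_quat_def scaleR_split_quat_def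
      algebra_simps)

end

lemmas split_quat_defs = zero_split_quat_def one_split_quat_def plus_split_quat_def
  uminus_split_quat_def minus_split_quat_def times_split_quat_def scaleR_split_quat_def

definition se1 :: split_quat where "se1 = SQuat 0 1 0 0"
definition se2 :: split_quat where "se2 = SQuat 0 0 1 0"
definition se3 :: split_quat where "se3 = SQuat 0 0 0 1"

lemma split_quat_basis:
  "x = s0 x *\<^sub>R 1 + s1 x *\<^sub>R se1 + s2 x *\<^sub>R se2 + s3 x *\<^sub>R se3"
  by (simp add: split_quat_eq_iff split_quat_defs se1_def se2_def se3_def)

lemma split_quat_mult_table:
  "se1 * se1 = 1" "se2 * se2 = - 1" "se3 * se3 = 1"
  "se1 * se2 = se3" "se2 * se1 = - se3"
  "se2 * se3 = se1" "se3 * se2 = - se1"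
  "se3 * se1 = - se2" "se1 * se3 = se2"
  by (simp_all add: split_quat_defs se1_def se2_def se3_def)

definition sconj :: "split_quat \<Rightarrow> split_quat" where
  "sconj x = SQuat (s0 x) (- s1 x) (- s2 x) (- s3 x)"

definition sinner :: "split_quat \<Rightarrow> split_quat \<Rightarrow> real" where
  "sinner x y = s0 ((1/2) *\<^sub>R (x * sconj y + y * sconj x))"

definition snorm :: "split_quat \<Rightarrow> real" where
  "snorm x = sinner x x"

lemma sinner_scalar: "of_real (sinner x y) = (1/2) *\<^sub>R (x * sconj y + y * sconj x)"
  by (simp add: of_real_def split_quat_eq_iff sinner_def sconj_def split_quat_defs
      algebra_simps)

lemma snorm_scalar: "of_real (snorm x) = x * sconj x"
  by (simp add: of_real_def split_quat_eq_iff snorm_def sinner_def sconj_def split_quat_defs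
      algebra_simps)

instantiation split_quat :: inverse
begin

definition "inverse x = (1 / snorm x) *\<^sub>R sconj x"
definition "x div y = x * inverse y" for x y :: split_quat

instance ..

end

lemma split_quat_inverse:
  assumes "snorm x \<noteq> 0"
  shows "x * inverse x = 1" "inverse x * x = 1"
proof -
  have "x * sconj x = snorm x *\<^sub>R 1" "sconj x * x = snorm x *\<^sub>R 1"
    by (simp_all add: split_quat_eq_iff snorm_def sinner_def sconj_def split_quat_defs
        algebra_simps)
  with assms show "x * inverse x = 1" "inverse x * x = 1"
    by (simp_all add: inverse_split_quat_def)
qed

definition spure :: "split_quat set" where
  "spure = {x. sconj x = - x}"

definition spure_nonzero :: "split_quat set" where
  "spure_nonzero = {x \<in> spure. x \<noteq> 0}"

definition sunits :: "split_quat set" where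
  "sunits = {x. snorm x \<noteq> 0}"

end

theory Submission
  imports Defs
begin

text \<open>
  Let \<open>a\<close> and \<open>b\<close> be pure of equal norm \<open>n\<close>.  Both squares are the scalar \<open>- n\<close>, and therefore
  every element of the form \<open>p = b * x + x * a\<close> satisfies \<open>p * a = b * p\<close>
  (\<open>intertwiner\<close>).  If such a \<open>p\<close> has nonzero norm, it is invertible and conjugates \<open>a\<close> to \<open>b\<close>.

  For quaternions over any field of characteristic \<open>0\<close>, an \<open>x\<close> that makes the norm of \<open>p\<close>
  nonzero exists (\<open>qnorm_intertwiner_nonzero\<close>).  Indeed \<open>qnorm (b * x + x * a)\<close> is a quadratic
  form in \<open>x\<close> whose values at the four basis elements add up to \<open>8 * n\<close>, so \<open>n = 0\<close> if the form
  vanishes identically.  But then its values at the basis elements and at the sums of two of them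
  make every product \<open>a\<^sub>i * b\<^sub>j\<close> of coordinates vanish, which forces \<open>a = 0\<close> or \<open>b = 0\<close>.
  The argument makes no distinction between isotropic and anisotropic elements.

  The split quaternions have the same complexification as the quaternions: they are the real span
  of \<open>1\<close>, \<open>\<i> e1\<close>, \<open>e2\<close>, \<open>\<i> e3\<close> among the complex quaternions.  A complex quadratic form that
  vanishes on this real form vanishes everywhere, so a suitable \<open>x\<close> can be found among the split
  quaternions as well (\<open>snorm_intertwiner_nonzero\<close>).

  For real quaternions \<open>p\<close> is to be pure.  There \<open>x = 1\<close> gives the pure element \<open>a + b\<close>, and since
  the norm is positive definite this serves unless \<open>b = - a\<close>.  In that case any nonzero pure
  element orthogonal to \<open>a\<close> anticommutes with \<open>a\<close> and so conjugates it to \<open>- a\<close>.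
\<close>

lemma intertwiner:
  fixes a b x :: "'a::ring"
  assumes "x * (a * a) = (b * b) * x"
  shows "(b * x + x * a) * a = b * (b * x + x * a)"
  using assms by (simp add: distrib_left distrib_right mult.assoc)

section \<open>Quaternions over a field\<close>

lemma qnorm_coords: "qnorm x = q0 x * q0 x + q1 x * q1 x + q2 x * q2 x + q3 x * q3 x"
  by (simp add: qnorm_def qinner_def qconj_def qscale_def quat_ring_defs)

lemma qpure_iff: "x \<in> qpure \<longleftrightarrow> q0 x = 0" for x :: "'a::field_char_0 quat"
  by (auto simp: qpure_def qconj_def uminus_quat_def quat_eq_iff)

lemma qpure_square:
  fixes a :: "'a::field_char_0 quat"
  assumes "a \<in> qpure"
  shows "a * a = qscale (- qnorm a) 1"
  using assms by (simp add: qpure_iff qnorm_coords qscale_def quat_ring_defs)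

lemma qscale_one_commutes: "x * qscale c 1 = qscale c 1 * x"
  by (simp add: qscale_def quat_ring_defs mult.commute)

lemma quat_conjugate:
  fixes p :: "'a::field_char_0 quat"
  assumes "p * a = b * p" and "qnorm p \<noteq> 0"
  shows "p * a * inverse p = b"
  using assms by (simp add: mult.assoc quat_inverse)

lemma qpure_intertwiner:
  fixes a b :: "'a::field_char_0 quat"
  assumes "a \<in> qpure" "b \<in> qpure" "qnorm a = qnorm b"
  shows "(b * x + x * a) * a = b * (b * x + x * a)"
  by (rule intertwiner) (simp add: assms qpure_square qscale_one_commutes)

text \<open>
  Write \<open>f\<close> for half the quadratic form \<open>x \<mapsto> qnorm (b * x + x * a)\<close>.  On the basis elements,
  \<open>f\<close> takes the values \<open>qnorm a \<plusminus> a1 * b1 \<plusminus> a2 * b2 \<plusminus> a3 * b3\<close>, where each product occurs twice with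
  each sign.  The mixed coefficients of \<open>f\<close> are, up to a factor, the coordinates of the cross
  product of \<open>a\<close> and \<open>b\<close> (for \<open>1\<close> and \<open>e\<^sub>k\<close>) and the symmetric combinations
  \<open>a\<^sub>i * b\<^sub>j + a\<^sub>j * b\<^sub>i\<close> (for \<open>e\<^sub>i\<close> and \<open>e\<^sub>j\<close>).  Together these coefficients determine all the
  products \<open>a\<^sub>i * b\<^sub>j\<close>.
\<close>

lemma qnorm_intertwiner_nonzero:
  fixes a b :: "'a::field_char_0 quat"
  assumes "a \<in> qpure" "b \<in> qpure" "qnorm a = qnorm b" "a \<noteq> 0" "b \<noteq> 0"
  shows "\<exists>x. qnorm (b * x + x * a) \<noteq> 0"
proof (rule ccontr)
  assume "\<nexists>x. qnorm (b * x + x * a) \<noteq> 0"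
  then have vanish: "qnorm (b * x + x * a) = 0" for x by blast
  obtain a1 a2 a3 b1 b2 b3 where a: "a = Quat 0 a1 a2 a3" and b: "b = Quat 0 b1 b2 b3"
    using assms(1,2) by (cases a; cases b) (simp add: qpure_iff)
  have norms: "a1 * a1 + a2 * a2 + a3 * a3 = b1 * b1 + b2 * b2 + b3 * b3"
    using assms(3) by (simp add: a b qnorm_coords)
  define f where "f x0 x1 x2 x3 =
       (a1 * a1 + a2 * a2 + a3 * a3) * (x0 * x0 + x1 * x1 + x2 * x2 + x3 * x3)
     + a1 * b1 * (x0 * x0 + x1 * x1 - x2 * x2 - x3 * x3)
     + a2 * b2 * (x0 * x0 + x2 * x2 - x1 * x1 - x3 * x3)
     + a3 * b3 * (x0 * x0 + x3 * x3 - x1 * x1 - x2 * x2)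
     + 2 * (a1 * b2 + a2 * b1) * x1 * x2 + 2 * (a1 * b2 - a2 * b1) * x0 * x3
     + 2 * (a1 * b3 + a3 * b1) * x1 * x3 + 2 * (a3 * b1 - a1 * b3) * x0 * x2
     + 2 * (a2 * b3 + a3 * b2) * x2 * x3 + 2 * (a2 * b3 - a3 * b2) * x0 * x1" for x0 x1 x2 x3
  have f: "f x0 x1 x2 x3 = 0" for x0 x1 x2 x3
  proof -
    define x where "x = Quat x0 x1 x2 x3"
    have "qnorm (b * x + x * a) = 2 * f x0 x1 x2 x3
      + (b1 * b1 + b2 * b2 + b3 * b3 - (a1 * a1 + a2 * a2 + a3 * a3)) * qnorm x"
      by (simp add: x_def a b qnorm_coords f_def plus_quat_def times_quat_def algebra_simps)
    then show ?thesis
      using norms vanish[of x] by simp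
  qed
  have n: "a1 * a1 + a2 * a2 + a3 * a3 = 0"
    using f[of 1 0 0 0] f[of 0 1 0 0] f[of 0 0 1 0] f[of 0 0 0 1] unfolding f_def by algebra
  have diag: "a1 * b1 = 0" "a2 * b2 = 0" "a3 * b3 = 0"
    using f[of 1 0 0 0] f[of 0 1 0 0] f[of 0 0 1 0] f[of 0 0 0 1] n unfolding f_def by algebra+
  have "a1 * b2 = 0" "a2 * b1 = 0"
    using f[of 0 1 1 0] f[of 1 0 0 1] n diag unfolding f_def by algebra+
  moreover have "a1 * b3 = 0" "a3 * b1 = 0"
    using f[of 0 1 0 1] f[of 1 0 1 0] n diag unfolding f_def by algebra+
  moreover have "a2 * b3 = 0" "a3 * b2 = 0"
    using f[of 0 0 1 1] f[of 1 1 0 0] n diag unfolding f_def by algebra+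
  ultimately have "a = 0 \<or> b = 0"
    using diag by (auto simp: a b zero_quat_def)
  with assms(4,5) show False by simp
qed

theorem pure_quaternions_conjugate_by_unit:
  fixes a b :: "'a::field_char_0 quat"
  assumes "a \<in> qpure_nonzero" "b \<in> qpure_nonzero" "qnorm a = qnorm b"
  shows "\<exists>p \<in> qunits. p * a * inverse p = b"
proof -
  have pure: "a \<in> qpure" "b \<in> qpure" and nz: "a \<noteq> 0" "b \<noteq> 0"
    using assms(1,2) by (simp_all add: qpure_nonzero_def)
  obtain x where x: "qnorm (b * x + x * a) \<noteq> 0"
    using qnorm_intertwiner_nonzero[OF pure assms(3) nz] by blast
  moreover have "(b * x + x * a) * a * inverse (b * x + x * a) = b"
    by (rule quat_conjugate[OF qpure_intertwiner[OF pure assms(3)] x])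
  ultimately show ?thesis
    by (auto simp: qunits_def)
qed

section \<open>Real quaternions\<close>

lemma real_qnorm_eq_0_iff: "qnorm x = 0 \<longleftrightarrow> x = 0" for x :: quaternion
proof -
  have "q0 x * q0 x + q1 x * q1 x + q2 x * q2 x + q3 x * q3 x = 0 \<longleftrightarrow>
    q0 x = 0 \<and> q1 x = 0 \<and> q2 x = 0 \<and> q3 x = 0"
    by (simp add: add_nonneg_eq_0_iff)
  then show ?thesis
    by (simp add: qnorm_coords quat_eq_iff zero_quat_def)
qed

text \<open>
  The witness is an element orthogonal to \<open>a\<close>: rotate the first two imaginary coordinates by a
  right angle, or take \<open>e1\<close> if both are \<open>0\<close>.
\<close>

lemma qpure_anticommuting_exists:
  fixes a :: "'a::field_char_0 quat"
  assumes "a \<in> qpure"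
  shows "\<exists>p \<in> qpure_nonzero. p * a = - a * p"
proof -
  define p where "p = (if q1 a = 0 \<and> q2 a = 0 then e1 else Quat 0 (- q2 a) (q1 a) 0)"
  have "p \<in> qpure_nonzero"
    by (auto simp: p_def qpure_nonzero_def qpure_iff e1_def zero_quat_def)
  moreover have "p * a = - a * p"
    using assms
    by (auto simp: p_def qpure_iff e1_def times_quat_def uminus_quat_def algebra_simps)
  ultimately show ?thesis by blast
qed

theorem pure_real_quaternions_conjugate_by_pure:
  fixes a b :: quaternion
  assumes "a \<in> qpure_nonzero" "b \<in> qpure_nonzero" "qnorm a = qnorm b"
  shows "\<exists>p \<in> qpure_nonzero. p * a * inverse p = b"
proof -
  have pure: "a \<in> qpure" "b \<in> qpure"
    using assms(1,2) by (simp_all add: qpure_nonzero_def)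
  obtain p where p: "p \<in> qpure_nonzero" "p * a = b * p"
  proof (cases "b + a = 0")
    case True
    then have "b = - a" by (simp add: eq_neg_iff_add_eq_0)
    then show ?thesis
      using qpure_anticommuting_exists[OF pure(1)] that by blast
  next
    case False
    then have "b + a \<in> qpure_nonzero"
      using pure by (simp add: qpure_nonzero_def qpure_iff plus_quat_def)
    moreover have "(b + a) * a = b * (b + a)"
      using qpure_intertwiner[OF pure assms(3), of 1] by simp
    ultimately show ?thesis by (rule that)
  qed
  then have "p * a * inverse p = b"
    by (intro quat_conjugate) (simp_all add: real_qnorm_eq_0_iff qpure_nonzero_def)
  with p(1) show ?thesis by blast
qed

section \<open>Split quaternions\<close>

lemma snorm_coords: "snorm x = s0 x * s0 x - s1 x * s1 x + s2 x * s2 x - s3 x * s3 x"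
  by (simp add: snorm_def sinner_def sconj_def split_quat_defs)

lemma spure_iff: "x \<in> spure \<longleftrightarrow> s0 x = 0"
  by (auto simp: spure_def sconj_def uminus_split_quat_def split_quat_eq_iff)

lemma spure_square:
  assumes "a \<in> spure"
  shows "a * a = (- snorm a) *\<^sub>R 1"
  using assms by (simp add: spure_iff snorm_coords split_quat_defs)

text \<open>
  Multiplying \<open>e1\<close> and \<open>e3\<close> by \<open>\<i>\<close> changes the signs of their squares and of \<open>e3 * e1\<close>, which
  turns the multiplication table of the quaternions into that of the split quaternions.
\<close>

definition cquat_of_split :: "split_quat \<Rightarrow> complex_quaternion" where
  "cquat_of_split x = Quat (of_real (s0 x)) (\<i> * of_real (s1 x)) (of_real (s2 x)) (\<i> * of_real (s3 x))"

lemma cquat_of_split_add: "cquat_of_split (x + y) = cquat_of_split x + cquat_of_split y"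
  by (simp add: cquat_of_split_def plus_split_quat_def plus_quat_def algebra_simps)

lemma cquat_of_split_mult: "cquat_of_split (x * y) = cquat_of_split x * cquat_of_split y"
  by (simp add: cquat_of_split_def times_split_quat_def times_quat_def complex_eq_iff)

lemma qnorm_cquat_of_split: "qnorm (cquat_of_split x) = of_real (snorm x)"
  by (simp add: cquat_of_split_def qnorm_coords snorm_coords complex_eq_iff)

lemma cquat_of_split_eq_0_iff: "cquat_of_split x = 0 \<longleftrightarrow> x = 0"
  by (simp add: cquat_of_split_def zero_quat_def split_quat_eq_iff zero_split_quat_def)

lemma cquat_of_split_pure: "x \<in> spure \<Longrightarrow> cquat_of_split x \<in> qpure"
  by (simp add: cquat_of_split_def spure_iff qpure_iff)

lemma split_complexification_decomp:
  "\<exists>u v. z = cquat_of_split u + qscale \<i> (cquat_of_split v)"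
proof (intro exI)
  show "z = cquat_of_split (SQuat (Re (q0 z)) (Im (q1 z)) (Re (q2 z)) (Im (q3 z)))
    + qscale \<i> (cquat_of_split (SQuat (Im (q0 z)) (- Re (q1 z)) (Im (q2 z)) (- Re (q3 z))))"
    by (simp add: quat_eq_iff cquat_of_split_def qscale_def plus_quat_def complex_eq_iff)
qed

text \<open>
  The polarization of a complex quadratic form: its values on the complexification of a real
  subspace are determined by its values on that subspace.
\<close>

lemma qnorm_complex_combination:
  fixes p q :: complex_quaternion
  shows "qnorm (p + qscale \<i> q) = qnorm p - qnorm q + \<i> * (qnorm (p + q) - qnorm p - qnorm q)"
  by (simp add: qnorm_coords qscale_def plus_quat_def complex_eq_iff algebra_simps)

lemma snorm_intertwiner_nonzero:
  assumes "a \<in> spure" "b \<in> spure" "snorm a = snorm b" "a \<noteq> 0" "b \<noteq> 0"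
  shows "\<exists>x. snorm (b * x + x * a) \<noteq> 0"
proof (rule ccontr)
  assume "\<nexists>x. snorm (b * x + x * a) \<noteq> 0"
  then have vanish: "snorm (b * x + x * a) = 0" for x by blast
  let ?a = "cquat_of_split a" and ?b = "cquat_of_split b"
  have "qnorm (?b * z + z * ?a) = 0" for z
  proof -
    obtain u v where z: "z = cquat_of_split u + qscale \<i> (cquat_of_split v)"
      using split_complexification_decomp by blast
    define p q where "p = b * u + u * a" and "q = b * v + v * a"
    have "?b * z + z * ?a = cquat_of_split p + qscale \<i> (cquat_of_split q)"
      unfolding z p_def q_def cquat_of_split_add cquat_of_split_mult
      by (simp add: quat_eq_iff qscale_def quat_ring_defs algebra_simps)
    moreover have "p + q = b * (u + v) + (u + v) * a"
      by (simp add: p_def q_def algebra_simps)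
    then have "snorm p = 0" "snorm q = 0" "snorm (p + q) = 0"
      using vanish by (simp_all add: p_def q_def)
    ultimately show ?thesis
      by (simp add: qnorm_complex_combination qnorm_cquat_of_split flip: cquat_of_split_add)
  qed
  then show False
    using qnorm_intertwiner_nonzero[of ?a ?b] assms
    by (simp add: cquat_of_split_pure qnorm_cquat_of_split cquat_of_split_eq_0_iff)
qed

theorem pure_split_quaternions_conjugate_by_unit:
  assumes "a \<in> spure_nonzero" "b \<in> spure_nonzero" "snorm a = snorm b"
  shows "\<exists>p \<in> sunits. p * a * inverse p = b"
proof -
  have pure: "a \<in> spure" "b \<in> spure" and nz: "a \<noteq> 0" "b \<noteq> 0"
    using assms(1,2) by (simp_all add: spure_nonzero_def)
  obtain x where x: "snorm (b * x + x * a) \<noteq> 0"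
    using snorm_intertwiner_nonzero[OF pure assms(3) nz] by blast
  define p where "p = b * x + x * a"
  have "p * a = b * p"
    unfolding p_def by (rule intertwiner) (simp add: spure_square pure assms(3))
  then have "p * a * inverse p = b"
    using x by (simp add: mult.assoc split_quat_inverse p_def)
  with x show ?thesis
    by (auto simp: sunits_def p_def)
qed

section \<open>Conjugacy in all three algebras\<close>

theorem theorem6:
  shows "(\<forall>a b :: quaternion. a \<in> qpure_nonzero \<longrightarrow> b \<in> qpure_nonzero \<longrightarrow> qnorm a = qnorm b \<longrightarrow>
            (\<exists>p \<in> qpure_nonzero. p * a * inverse p = b)) \<and>
         (\<forall>a b :: split_quat. a \<in> spure_nonzero \<longrightarrow> b \<in> spure_nonzero \<longrightarrow> snorm a = snorm b \<longrightarrow>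
            (\<exists>p \<in> sunits. p * a * inverse p = b)) \<and>
         (\<forall>a b :: complex_quaternion. a \<in> qpure_nonzero \<longrightarrow> b \<in> qpure_nonzero \<longrightarrow> qnorm a = qnorm b \<longrightarrow>
            (\<exists>p \<in> qunits. p * a * inverse p = b))"
  by (intro conjI allI impI pure_real_quaternions_conjugate_by_pure
      pure_split_quaternions_conjugate_by_unit pure_quaternions_conjugate_by_unit)

end
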